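(* Let $D$ be a proper closed subspace of $L_p(S;X)$. Then, for any $\varphi\in L_q(S;X^* )$, $$\mathcal{S}_D(\varphi)\neq\emptyset\iff\mathcal{S}_D(\varphi)=D\iff\varphi\perp D.$$
   Context: Setting: $(S,\mathcal{A},\mu)$ is a positive complete measure space, $(X,\|\cdot\|_X)$ is a real uniformly convex and uniformly smooth Banach space with dual $X^*$, and $1<p,q<\infty$ with $\frac1p+\frac1q=1$. $L_p(S;X)$ is the Bochner space of ($\mu$-equivalence classes of) strongly $\mu$-measurable $f:S\to X$ with $\|f\|_{L_p(S;X)}=\left(\int_S\|f(s)\|_X^p\,d\mu(s)\right)^{1/p}<\infty$; it is uniformly convex and uniformly smooth with dual $L_q(S;X^* )$ under the pairing $\langle\varphi,f\rangle=\int_S\langle\varphi(s),f(s)\rangle\,d\mu(s)$. For a nonempty closed convex $C\subseteq L_p(S;X)$ and $\varphi\in L_q(S;X^* )$, the solution set is $$\mathcal{S}_C(\varphi)=\left\{g\in C:\ \int_S\langle\varphi(s),g(s)\rangle\,d\mu(s)=\sup_{f\in C}\int_S\langle\varphi(s),f(s)\rangle\,d\mu(s)\right\}.$$ $\varphi\perp D$ means $\langle\varphi,f\rangle=0$ for every $f\in D$. "Subspace" means linear subspace. *)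

theory Defs
  imports "HOL-Analysis.Analysis"
begin

section \<open>Uniform convexity and uniform smoothness\<close>

definition uniformly_convex :: "'x::real_normed_vector itself \<Rightarrow> bool" where
  "uniformly_convex _ \<longleftrightarrow>
     (\<forall>\<epsilon>>0. \<exists>\<delta>>0. \<forall>x y :: 'x. norm x = 1 \<and> norm y = 1 \<and> norm (x - y) \<ge> \<epsilon>
        \<longrightarrow> norm ((x + y) /\<^sub>R 2) \<le> 1 - \<delta>)"

text \<open>This is the statement that the modulus of smoothness
  \<open>\<rho>(\<tau>) = sup {(\<parallel>x + y\<parallel> + \<parallel>x - y\<parallel>) / 2 - 1 | \<parallel>x\<parallel> = 1, \<parallel>y\<parallel> = \<tau>}\<close>
  satisfies \<open>\<rho>(\<tau>) / \<tau> \<rightarrow> 0\<close> as \<open>\<tau>\<close> decreases to 0.\<close>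

definition uniformly_smooth :: "'x::real_normed_vector itself \<Rightarrow> bool" where
  "uniformly_smooth _ \<longleftrightarrow>
     (\<forall>\<epsilon>>0. \<exists>\<delta>>0. \<forall>x y :: 'x. norm x = 1 \<and> norm y \<le> \<delta>
        \<longrightarrow> (norm (x + y) + norm (x - y)) / 2 - 1 \<le> \<epsilon> * norm y)"

section \<open>Bochner spaces\<close>

text \<open>The library's Bochner integral and Borel measurability of sums need a second-countable
  target. As no separability of \<open>X\<close> is assumed here, strong measurability is defined directly:
  almost everywhere convergence of a sequence of simple functions supported on sets of finite
  measure.\<close>

definition strongly_measurable ::
    "'s measure \<Rightarrow> ('s \<Rightarrow> 'x::real_normed_vector) \<Rightarrow> bool" where
  "strongly_measurable M f \<longleftrightarrow>
     (\<exists>u. (\<forall>n::nat. Bochner_Integration.simple_bochner_integrable M (u n)) \<and>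
          (AE s in M. (\<lambda>n. u n s) \<longlonglongrightarrow> f s))"

definition Lp_fun :: "'s measure \<Rightarrow> real \<Rightarrow> ('s \<Rightarrow> 'x::real_normed_vector) set" where
  "Lp_fun M p = {f. strongly_measurable M f \<and>
     (\<integral>\<^sup>+ s. ennreal (norm (f s) powr p) \<partial>M) < \<infinity>}"

definition Lp_rel ::
    "'s measure \<Rightarrow> real \<Rightarrow> (('s \<Rightarrow> 'x::real_normed_vector) \<times> ('s \<Rightarrow> 'x)) set" where
  "Lp_rel M p = {(f, g). f \<in> Lp_fun M p \<and> g \<in> Lp_fun M p \<and> (AE s in M. f s = g s)}"

lemma equiv_Lp_rel: "equiv (Lp_fun M p) (Lp_rel M p)"
proof (rule equivI)
  show "Lp_rel M p \<subseteq> Lp_fun M p \<times> Lp_fun M p"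
    by (auto simp: Lp_rel_def)
  show "refl_on (Lp_fun M p) (Lp_rel M p)"
    by (auto simp: refl_on_def Lp_rel_def)
  show "sym (Lp_rel M p)"
    by (auto simp: sym_def Lp_rel_def elim: eventually_mono)
  show "trans (Lp_rel M p)"
    by (auto simp: trans_def Lp_rel_def elim: eventually_elim2)
qed

definition Lp :: "'s measure \<Rightarrow> real \<Rightarrow> ('s \<Rightarrow> 'x::real_normed_vector) set set" where
  "Lp M p = Lp_fun M p // Lp_rel M p"

definition Lp_class ::
    "'s measure \<Rightarrow> real \<Rightarrow> ('s \<Rightarrow> 'x::real_normed_vector) \<Rightarrow> ('s \<Rightarrow> 'x) set" where
  "Lp_class M p f = Lp_rel M p `` {f}"

text \<open>The operations below are computed on an arbitrarily chosen representative; on elements of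
  \<^const>\<open>Lp\<close> the result does not depend on the choice.\<close>

definition rep :: "('s \<Rightarrow> 'x) set \<Rightarrow> 's \<Rightarrow> 'x" where
  "rep F = (SOME f. f \<in> F)"

lemma rep_in: "F \<in> Lp M p \<Longrightarrow> rep F \<in> F"
  unfolding rep_def Lp_def
  using in_quotient_imp_non_empty[OF equiv_Lp_rel, of F M p] by (simp add: some_in_eq)

definition Lp_zero :: "'s measure \<Rightarrow> real \<Rightarrow> ('s \<Rightarrow> 'x::real_normed_vector) set" where
  "Lp_zero M p = Lp_class M p (\<lambda>_. 0)"

definition Lp_add :: "'s measure \<Rightarrow> real \<Rightarrow>
    ('s \<Rightarrow> 'x::real_normed_vector) set \<Rightarrow> ('s \<Rightarrow> 'x) set \<Rightarrow> ('s \<Rightarrow> 'x) set" where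
  "Lp_add M p F G = Lp_class M p (\<lambda>s. rep F s + rep G s)"

definition Lp_scale :: "'s measure \<Rightarrow> real \<Rightarrow>
    real \<Rightarrow> ('s \<Rightarrow> 'x::real_normed_vector) set \<Rightarrow> ('s \<Rightarrow> 'x) set" where
  "Lp_scale M p c F = Lp_class M p (\<lambda>s. c *\<^sub>R rep F s)"

definition Lp_norm ::
    "'s measure \<Rightarrow> real \<Rightarrow> ('s \<Rightarrow> 'x::real_normed_vector) set \<Rightarrow> real" where
  "Lp_norm M p F = (\<integral>s. norm (rep F s) powr p \<partial>M) powr (1 / p)"

definition Lp_dist :: "'s measure \<Rightarrow> real \<Rightarrow>
    ('s \<Rightarrow> 'x::real_normed_vector) set \<Rightarrow> ('s \<Rightarrow> 'x) set \<Rightarrow> real" where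
  "Lp_dist M p F G = Lp_norm M p (Lp_add M p F (Lp_scale M p (-1) G))"

definition Lp_subspace ::
    "'s measure \<Rightarrow> real \<Rightarrow> ('s \<Rightarrow> 'x::real_normed_vector) set set \<Rightarrow> bool" where
  "Lp_subspace M p D \<longleftrightarrow>
     D \<subseteq> Lp M p \<and> Lp_zero M p \<in> D \<and>
     (\<forall>F\<in>D. \<forall>G\<in>D. Lp_add M p F G \<in> D) \<and>
     (\<forall>c. \<forall>F\<in>D. Lp_scale M p c F \<in> D)"

definition Lp_closed ::
    "'s measure \<Rightarrow> real \<Rightarrow> ('s \<Rightarrow> 'x::real_normed_vector) set set \<Rightarrow> bool" where
  "Lp_closed M p D \<longleftrightarrow> closedin (Metric_space.mtopology (Lp M p) (Lp_dist M p)) D"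

section \<open>Duality pairing and solution sets\<close>

definition pairing ::
    "'s measure \<Rightarrow> ('s \<Rightarrow> 'x \<Rightarrow>\<^sub>L real) set \<Rightarrow> ('s \<Rightarrow> 'x::real_normed_vector) set \<Rightarrow> real" where
  "pairing M \<Phi> F = (\<integral>s. blinfun_apply (rep \<Phi> s) (rep F s) \<partial>M)"

text \<open>The supremum is taken in the extended reals, so that an unbounded functional has
  supremum \<open>\<infinity>\<close> (which is not attained) rather than an unspecified real value.\<close>

definition solution_set :: "'s measure \<Rightarrow>
    ('s \<Rightarrow> 'x::real_normed_vector) set set \<Rightarrow> ('s \<Rightarrow> 'x \<Rightarrow>\<^sub>L real) set \<Rightarrow> ('s \<Rightarrow> 'x) set set" where
  "solution_set M C \<Phi> =
     {G \<in> C. ereal (pairing M \<Phi> G) = (SUP F\<in>C. ereal (pairing M \<Phi> F))}"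

definition annihilates :: "'s measure \<Rightarrow>
    ('s \<Rightarrow> 'x \<Rightarrow>\<^sub>L real) set \<Rightarrow> ('s \<Rightarrow> 'x::real_normed_vector) set set \<Rightarrow> bool" where
  "annihilates M \<Phi> D \<longleftrightarrow> (\<forall>F\<in>D. pairing M \<Phi> F = 0)"

end

theory Submission
  imports Defs
begin

text \<open>A linear functional that is bounded above on a linear subspace vanishes there: if
  \<open>\<langle>\<Phi>, F\<rangle> = m\<close>, then the values \<open>c m\<close> are attained at the multiples \<open>c F\<close>, and they
  have no upper bound unless \<open>m = 0\<close>.  Hence the supremum of \<open>\<Phi>\<close> over \<open>D\<close> can be attained only
  if \<open>\<Phi>\<close> is constantly zero on \<open>D\<close>, and in that case every element of \<open>D\<close> attains it.

  What carries this over to classes of functions is that the pairing is homogeneous in its second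
  argument (\<open>pairing_Lp_scale\<close>).  Homogeneity is an almost everywhere matter, because the
  representative chosen for \<open>c F\<close> agrees with \<open>c\<close> times the one chosen for \<open>F\<close> only outside a
  null set.  On a complete measure space the integral does not see this difference, whether or
  not the integrand is measurable (\<open>integral_cong_AE_complete\<close>).\<close>

text \<open>On a complete space the preimages of a Borel set under two almost everywhere equal
  functions differ by a subset of a null set, and such a subset is measurable.\<close>

lemma (in complete_measure) borel_measurable_cong_AE_complete:
  fixes f g :: "'a \<Rightarrow> 'b::topological_space"
  assumes f: "f \<in> borel_measurable M" and eq: "AE x in M. f x = g x"
  shows "g \<in> borel_measurable M"
proof (rule measurableI)
  fix A :: "'b set" assume A: "A \<in> sets borel"
  from eq obtain N where N: "{x \<in> space M. f x \<noteq> g x} \<subseteq> N" "N \<in> null_sets M"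
    by (auto elim!: AE_E simp: null_sets_def)
  have small: "B \<in> sets M" if "B \<subseteq> N" for B
    using complete[OF that N(2)] .
  have "g -` A \<inter> space M = (f -` A \<inter> space M - N) \<union> (g -` A \<inter> space M \<inter> N)"
    using N(1) by auto
  moreover have "f -` A \<inter> space M - N \<in> sets M"
    using measurable_sets[OF f A] N(2) by (intro sets.Diff) auto
  moreover have "g -` A \<inter> space M \<inter> N \<in> sets M"
    by (rule small) auto
  ultimately show "g -` A \<inter> space M \<in> sets M"
    by (metis sets.Un)
qed auto

text \<open>By the previous lemma both integrands are measurable or neither is; in the second case
  both integrals take the default value 0.\<close>

lemma (in complete_measure) integral_cong_AE_complete:
  fixes f g :: "'a \<Rightarrow> 'b::{banach, second_countable_topology}"
  assumes eq: "AE x in M. f x = g x"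
  shows "(\<integral>x. f x \<partial>M) = (\<integral>x. g x \<partial>M)"
proof (cases "f \<in> borel_measurable M")
  case True
  then show ?thesis
    using borel_measurable_cong_AE_complete eq by (blast intro: integral_cong_AE)
next
  case False
  have "AE x in M. g x = f x"
    using eq by (auto elim: eventually_mono)
  then have "g \<notin> borel_measurable M"
    using False borel_measurable_cong_AE_complete by blast
  then show ?thesis
    using False by (metis borel_measurable_integrable not_integrable_integral_eq)
qed

text \<open>Membership of \<open>c F\<close> in \<^const>\<open>Lp\<close> says that its class is nonempty, so that the
  representative chosen for it is an honest member of the class of \<open>c\<close> times the one of \<open>F\<close>.\<close>

lemma rep_Lp_scale_AE:
  assumes "Lp_scale M p c F \<in> Lp M p"
  shows "AE s in M. rep (Lp_scale M p c F) s = c *\<^sub>R rep F s"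
proof -
  have "rep (Lp_scale M p c F) \<in> Lp_class M p (\<lambda>s. c *\<^sub>R rep F s)"
    using rep_in[OF assms] by (simp add: Lp_scale_def)
  then have "AE s in M. c *\<^sub>R rep F s = rep (Lp_scale M p c F) s"
    by (simp add: Lp_class_def Lp_rel_def)
  then show ?thesis
    by (auto elim: eventually_mono)
qed

lemma pairing_Lp_scale:
  assumes "complete_measure M" and "Lp_scale M p c F \<in> Lp M p"
  shows "pairing M \<Phi> (Lp_scale M p c F) = c * pairing M \<Phi> F"
proof -
  interpret complete_measure M by fact
  have "AE s in M. blinfun_apply (rep \<Phi> s) (rep (Lp_scale M p c F) s)
      = c * blinfun_apply (rep \<Phi> s) (rep F s)"
    using rep_Lp_scale_AE[OF assms(2)] by eventually_elim (simp add: blinfun.scaleR_right)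
  then have "pairing M \<Phi> (Lp_scale M p c F)
      = (\<integral>s. c * blinfun_apply (rep \<Phi> s) (rep F s) \<partial>M)"
    unfolding pairing_def by (rule integral_cong_AE_complete)
  then show ?thesis
    by (simp add: pairing_def)
qed

lemma solution_set_eq_if_annihilates:
  assumes "annihilates M \<Phi> C"
  shows "solution_set M C \<Phi> = C"
proof -
  have "(SUP F\<in>C. ereal (pairing M \<Phi> F)) = 0" if "G \<in> C" for G
  proof (rule antisym)
    show "(SUP F\<in>C. ereal (pairing M \<Phi> F)) \<le> 0"
      using assms by (auto simp: annihilates_def intro!: SUP_least)
    show "0 \<le> (SUP F\<in>C. ereal (pairing M \<Phi> F))"
      using assms that by (auto simp: annihilates_def intro!: SUP_upper2[of G])
  qed
  then show ?thesis
    using assms by (auto simp: solution_set_def annihilates_def)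
qed

text \<open>Comparing a maximiser \<open>G\<close> with \<open>c F\<close> bounds every multiple \<open>c \<langle>\<Phi>, F\<rangle>\<close> by the fixed
  number \<open>\<langle>\<Phi>, G\<rangle>\<close>, which forces \<open>\<langle>\<Phi>, F\<rangle> = 0\<close>.\<close>

lemma annihilates_if_solution_set_nonempty:
  assumes "complete_measure M" and "D \<subseteq> Lp M p"
    and scale: "\<And>c F. F \<in> D \<Longrightarrow> Lp_scale M p c F \<in> D"
    and "solution_set M D \<Phi> \<noteq> {}"
  shows "annihilates M \<Phi> D"
proof -
  from assms(4) obtain G where G: "G \<in> D"
      "ereal (pairing M \<Phi> G) = (SUP F\<in>D. ereal (pairing M \<Phi> F))"
    by (auto simp: solution_set_def)
  have le: "c * pairing M \<Phi> F \<le> pairing M \<Phi> G" if "F \<in> D" for c F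
  proof -
    have "pairing M \<Phi> (Lp_scale M p c F) = c * pairing M \<Phi> F"
      using assms(1,2) scale[OF that] by (blast intro: pairing_Lp_scale)
    moreover have "ereal (pairing M \<Phi> (Lp_scale M p c F)) \<le> ereal (pairing M \<Phi> G)"
      unfolding G(2) using scale[OF that] by (rule SUP_upper)
    ultimately show ?thesis by simp
  qed
  have "pairing M \<Phi> F = 0" if "F \<in> D" for F
  proof (rule ccontr)
    assume "pairing M \<Phi> F \<noteq> 0"
    then show False
      \<comment> \<open>this multiple of \<open>F\<close> has pairing \<open>\<langle>\<Phi>, G\<rangle> + 1\<close>\<close>
      using le[OF that, of "(pairing M \<Phi> G + 1) / pairing M \<Phi> F"] by simp
  qed
  then show ?thesis by (simp add: annihilates_def)
qed

theorem theorem4p6: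
  fixes M :: "'s measure"
    and p q :: real
    and D :: "('s \<Rightarrow> 'x::banach) set set"
    and \<Phi> :: "('s \<Rightarrow> 'x \<Rightarrow>\<^sub>L real) set"
  assumes "complete_measure M"
    and "uniformly_convex TYPE('x)"
    and "uniformly_smooth TYPE('x)"
    and "1 < p" and "1 < q" and "1 / p + 1 / q = 1"
    and "Lp_subspace M p D" and "Lp_closed M p D" and "D \<noteq> Lp M p"
    and "\<Phi> \<in> Lp M q"
  shows "(solution_set M D \<Phi> \<noteq> {} \<longleftrightarrow> solution_set M D \<Phi> = D) \<and>
         (solution_set M D \<Phi> = D \<longleftrightarrow> annihilates M \<Phi> D)"
proof -
  have D: "D \<subseteq> Lp M p" "D \<noteq> {}" "\<And>c F. F \<in> D \<Longrightarrow> Lp_scale M p c F \<in> D"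
    using \<open>Lp_subspace M p D\<close> by (auto simp: Lp_subspace_def)
  have "annihilates M \<Phi> D" if "solution_set M D \<Phi> \<noteq> {}"
    using \<open>complete_measure M\<close> D(1,3) that by (rule annihilates_if_solution_set_nonempty)
  moreover have "solution_set M D \<Phi> = D" if "annihilates M \<Phi> D"
    using that by (rule solution_set_eq_if_annihilates)
  ultimately show ?thesis
    using D(2) by auto
qed

end
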